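(* Let $\mathcal{A}$ be a Banach algebra with a (uniformly bounded) $d$-parameter automorphism group $\Psi$. For all parameters $1\le p\le\infty$ and $r>0$, the Besov space $\Lambda^p_r(\mathcal{A})$ is a Banach subalgebra of $\mathcal{A}$. Moreover, $\Lambda^p_r(\mathcal{A})$ is inverse-closed in $\mathcal{A}$.
   Context: Banach algebras are complex and unital; a Banach space with a multiplication satisfying $\|ab\|\le C\|a\|\|b\|$ for some constant $C$ is regarded as a Banach algebra (it is one for an equivalent norm). A subalgebra $\mathcal{B}\subseteq\mathcal{A}$ with the same multiplication and identity is inverse-closed in $\mathcal{A}$ if $b\in\mathcal{B}$ and $b^{-1}\in\mathcal{A}$ imply $b^{-1}\in\mathcal{B}$. A $d$-parameter automorphism group acting on a Banach algebra $\mathcal{A}$ is a family $\Psi=\{\psi_t\}_{t\in\mathbb{R}^d}$ of Banach algebra automorphisms of $\mathcal{A}$ with $\psi_s\psi_t=\psi_{s+t}$ for all $s,t\in\mathbb{R}^d$ (consisting of $*$-automorphisms if $\mathcal{A}$ is a $*$-algebra). It is always assumed uniformly bounded: $M_\Psi=\sup_{t\in\mathbb{R}^d}\|\psi_t\|_{\mathcal{A}\to\mathcal{A}}<\infty$. Strong continuity of $t\mapsto\psi_t(a)$ is not assumed. Put $\Delta_t=\psi_t-\mathrm{id}$, $\Delta_t^k=(\psi_t-\mathrm{id})^k$ and $\omega^k_h(a)=\sup_{|t|\le h}\|\Delta_t^k a\|_{\mathcal{A}}$ for $h>0$, where $|t|=\sum_j|t_j|$ (any other norm on $\mathbb{R}^d$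 gives the same spaces with equivalent norms). For $1\le p\le\infty$, $r>0$ and $l=\lfloor r\rfloor+1$, the Besov space $\Lambda^p_r(\mathcal{A})$ consists of all $a\in\mathcal{A}$ for which $\|a\|_{\Lambda^p_r(\mathcal{A})}=\|a\|_{\mathcal{A}}+\bigl(\int_0^\infty (h^{-r}\omega^l_h(a))^p\,\frac{dh}{h}\bigr)^{1/p}$ is finite (for $p=\infty$: $\|a\|_{\mathcal{A}}+\sup_{h>0}h^{-r}\omega^l_h(a)$, up to equivalence of norms). *)

theory Defs
  imports "HOL-Analysis.Analysis"
begin

text \<open>
  Complex unital Banach algebras. The multiplication is only required to be bounded with some
  constant \<open>C\<close>, and \<open>norm 1 = 1\<close> is not required; this is why
  \<^class>\<open>real_normed_algebra_1\<close> is not used.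
\<close>

class complex_banach_algebra = banach + ring_1 +
  fixes scaleC :: "complex \<Rightarrow> 'a \<Rightarrow> 'a"  (infixr "*\<^sub>C" 75)
  assumes scaleC_add_right: "c *\<^sub>C (x + y) = c *\<^sub>C x + c *\<^sub>C y"
    and scaleC_add_left: "(c + e) *\<^sub>C x = c *\<^sub>C x + e *\<^sub>C x"
    and scaleC_scaleC: "c *\<^sub>C (e *\<^sub>C x) = (c * e) *\<^sub>C x"
    and scaleC_of_real: "complex_of_real s *\<^sub>C x = s *\<^sub>R x"
    and norm_scaleC: "norm (c *\<^sub>C x) = cmod c * norm x"
    and mult_scaleC_left: "(c *\<^sub>C x) * y = c *\<^sub>C (x * y)"
    and mult_scaleC_right: "x * (c *\<^sub>C y) = c *\<^sub>C (x * y)"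
    and norm_mult_bounded: "\<exists>C. \<forall>x y. norm (x * y) \<le> C * norm x * norm y"

text \<open>
  \<open>B\<close> is a unital complex subalgebra of the ambient algebra, and a Banach algebra for the norm
  \<open>N\<close> (whose values outside \<open>B\<close> are irrelevant), continuously embedded in the ambient algebra.
\<close>

definition banach_subalgebra :: "'a::complex_banach_algebra set \<Rightarrow> ('a \<Rightarrow> real) \<Rightarrow> bool" where
  "banach_subalgebra B N \<longleftrightarrow>
     0 \<in> B \<and> 1 \<in> B \<and>
     (\<forall>x\<in>B. \<forall>y\<in>B. x + y \<in> B) \<and>
     (\<forall>c. \<forall>x\<in>B. c *\<^sub>C x \<in> B) \<and>
     (\<forall>x\<in>B. \<forall>y\<in>B. x * y \<in> B) \<and>
     (\<forall>x\<in>B. 0 \<le> N x) \<and>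
     (\<forall>x\<in>B. N x = 0 \<longleftrightarrow> x = 0) \<and>
     (\<forall>x\<in>B. \<forall>y\<in>B. N (x + y) \<le> N x + N y) \<and>
     (\<forall>c. \<forall>x\<in>B. N (c *\<^sub>C x) = cmod c * N x) \<and>
     (\<forall>f::nat \<Rightarrow> 'a. (\<forall>n. f n \<in> B) \<longrightarrow>
        (\<forall>e>0. \<exists>K. \<forall>m\<ge>K. \<forall>n\<ge>K. N (f m - f n) < e) \<longrightarrow>
        (\<exists>l\<in>B. (\<lambda>n. N (f n - l)) \<longlonglongrightarrow> 0)) \<and>
     (\<exists>C. \<forall>x\<in>B. \<forall>y\<in>B. N (x * y) \<le> C * N x * N y) \<and>
     (\<exists>C. \<forall>x\<in>B. norm x \<le> C * N x)"

definition inverse_closed :: "'a::complex_banach_algebra set \<Rightarrow> bool" where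
  "inverse_closed B \<longleftrightarrow> (\<forall>b\<in>B. \<forall>c. b * c = 1 \<and> c * b = 1 \<longrightarrow> c \<in> B)"

definition banach_algebra_automorphism ::
    "('a::complex_banach_algebra \<Rightarrow> 'a) \<Rightarrow> bool" where
  "banach_algebra_automorphism f \<longleftrightarrow>
     bij f \<and> bounded_linear f \<and>
     (\<forall>c x. f (c *\<^sub>C x) = c *\<^sub>C f x) \<and>
     (\<forall>x y. f (x * y) = f x * f y) \<and>
     f 1 = 1"

definition automorphism_group ::
    "(real ^ 'd \<Rightarrow> 'a::complex_banach_algebra \<Rightarrow> 'a) \<Rightarrow> bool" where
  "automorphism_group \<psi> \<longleftrightarrow>
     (\<forall>t. banach_algebra_automorphism (\<psi> t)) \<and>
     (\<forall>s t. \<psi> s \<circ> \<psi> t = \<psi> (s + t)) \<and>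
     bdd_above (range (\<lambda>t. onorm (\<psi> t)))"

definition difference_op :: "(real ^ 'd \<Rightarrow> 'a::complex_banach_algebra \<Rightarrow> 'a) \<Rightarrow>
    real ^ 'd \<Rightarrow> 'a \<Rightarrow> 'a" where
  "difference_op \<psi> t a = \<psi> t a - a"

text \<open>
  The supremum is taken in the reals. For a uniformly bounded group with bound \<open>M\<close> the set is
  bounded above by \<open>(M + 1) ^ k * norm a\<close>, so this is the true supremum.
\<close>

definition modulus_of_smoothness :: "(real ^ 'd \<Rightarrow> 'a::complex_banach_algebra \<Rightarrow> 'a) \<Rightarrow>
    nat \<Rightarrow> real \<Rightarrow> 'a \<Rightarrow> real" where
  "modulus_of_smoothness \<psi> k h a =
     (SUP t \<in> {t. (\<Sum>j\<in>UNIV. \<bar>t $ j\<bar>) \<le> h}. norm ((difference_op \<psi> t ^^ k) a))"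

definition besov_integral :: "(real ^ 'd \<Rightarrow> 'a::complex_banach_algebra \<Rightarrow> 'a) \<Rightarrow>
    real \<Rightarrow> real \<Rightarrow> 'a \<Rightarrow> ennreal" where
  "besov_integral \<psi> p r a =
     (\<integral>\<^sup>+ h \<in> {0<..}. ennreal
        ((h powr (-r) * modulus_of_smoothness \<psi> (nat \<lfloor>r\<rfloor> + 1) h a) powr p / h) \<partial>lborel)"

definition besov_seminorm :: "(real ^ 'd \<Rightarrow> 'a::complex_banach_algebra \<Rightarrow> 'a) \<Rightarrow>
    ennreal \<Rightarrow> real \<Rightarrow> 'a \<Rightarrow> ennreal" where
  "besov_seminorm \<psi> p r a =
     (if p = \<infinity> then
        (SUP h \<in> {0<..}. ennreal
           (h powr (-r) * modulus_of_smoothness \<psi> (nat \<lfloor>r\<rfloor> + 1) h a))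
      else if besov_integral \<psi> (enn2real p) r a = \<infinity> then \<infinity>
      else ennreal (enn2real (besov_integral \<psi> (enn2real p) r a) powr (1 / enn2real p)))"

definition besov_space :: "(real ^ 'd \<Rightarrow> 'a::complex_banach_algebra \<Rightarrow> 'a) \<Rightarrow>
    ennreal \<Rightarrow> real \<Rightarrow> 'a set" where
  "besov_space \<psi> p r = {a. besov_seminorm \<psi> p r a < \<infinity>}"

definition besov_norm :: "(real ^ 'd \<Rightarrow> 'a::complex_banach_algebra \<Rightarrow> 'a) \<Rightarrow>
    ennreal \<Rightarrow> real \<Rightarrow> 'a \<Rightarrow> real" where
  "besov_norm \<psi> p r a = norm a + enn2real (besov_seminorm \<psi> p r a)"

end

theory Submission
  imports Defs
begin

text \<open>
  Fix \<open>t\<close> and put \<open>T = \<psi>\<^sub>t\<close>, \<open>D = T - id\<close>. Since \<open>T\<close> is power bounded, a discrete Landau inequality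
  bounds \<open>norm (D x)\<^sup>2\<close> by a multiple of \<open>norm x * norm (D (D x))\<close>, so that
  \<open>k \<mapsto> norm (D\<^sup>k a) * norm (D\<^sup>l\<^sup>-\<^sup>k b)\<close> is log-convex up to a constant and all mixed terms
  in the Leibniz expansion of \<open>D\<^sup>l (a * b)\<close> are controlled by the two extreme ones. This gives, with
  constants independent of \<open>t\<close>, bounds of \<open>norm (D\<^sup>l (a * b))\<close> by a multiple of
  \<open>norm a * norm (D\<^sup>l b) + norm b * norm (D\<^sup>l a)\<close> and, expanding \<open>D\<^sup>l (a * a\<^sup>-\<^sup>1) = 0\<close>, of
  \<open>norm (D\<^sup>l a\<^sup>-\<^sup>1)\<close> by a multiple of \<open>norm (D\<^sup>l a)\<close>. Hence the moduli of smoothness satisfy the same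
  inequalities at every scale \<open>h\<close>, and multiplication and inversion are compatible with any
  monotone norm of the modulus. Completeness follows from Fatou's lemma.
\<close>

section \<open>Power-bounded operators and the discrete Landau inequality\<close>

locale power_bounded_operator =
  fixes T :: "'a::real_normed_vector \<Rightarrow> 'a" and M :: real
  assumes bounded_linear: "bounded_linear T"
    and power_bounded: "norm ((T ^^ n) x) \<le> M * norm x"
    and bound_ge_1: "1 \<le> M"
begin

definition D :: "'a \<Rightarrow> 'a" where "D x = T x - x"

lemma linear: "linear T"
  using bounded_linear by (rule bounded_linear.linear)

lemma funpow_linear: "linear (T ^^ n)"
proof (induction n)
  case (Suc n)
  from linear_compose[OF this linear] show ?case by (simp add: o_def)
qed (simp add: linear_ident)

lemma funpow_commute: "(T ^^ n) (D x) = D ((T ^^ n) x)"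
  by (simp add: D_def linear_diff[OF funpow_linear] funpow_swap1)

lemma norm_D_le: "norm (D x) \<le> (M + 1) * norm x"
  using power_bounded[of 1 x] norm_triangle_ineq4[of "T x" x]
  by (simp add: D_def algebra_simps)

lemma norm_D_funpow_le: "norm ((D ^^ k) x) \<le> (M + 1) ^ k * norm x"
proof (induction k)
  case (Suc k)
  have "norm ((D ^^ Suc k) x) \<le> (M + 1) * norm ((D ^^ k) x)"
    using norm_D_le by simp
  also have "\<dots> \<le> (M + 1) * ((M + 1) ^ k * norm x)"
    using Suc bound_ge_1 by (intro mult_left_mono) auto
  finally show ?case by (simp add: mult_ac)
qed simp

text \<open>Telescoping: \<open>(T ^^ n) x - x\<close> is the sum of the \<open>n\<close> terms
  \<open>(T ^^ i) (D x)\<close>, each bounded by \<open>M * norm (D x)\<close>.\<close>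

lemma norm_funpow_diff_le: "norm ((T ^^ n) x - x) \<le> real n * M * norm (D x)"
proof (induction n)
  case (Suc n)
  have "(T ^^ Suc n) x - x = (T ^^ n) (D x) + ((T ^^ n) x - x)"
    by (simp add: D_def linear_diff[OF funpow_linear] funpow_swap1)
  then have "norm ((T ^^ Suc n) x - x) \<le> norm ((T ^^ n) (D x)) + norm ((T ^^ n) x - x)"
    by (metis norm_triangle_ineq)
  then show ?case
    using Suc power_bounded[of n "D x"] by (simp add: algebra_simps)
qed simp

text \<open>A first-order Taylor formula with \<open>D\<close> as derivative: passing from
  \<open>n\<close> to \<open>n + 1\<close> adds \<open>(T ^^ n) (D x) - D x\<close> to the
  remainder, which the previous lemma bounds when applied to \<open>D x\<close>.\<close>

lemma norm_funpow_taylor_le: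
  "norm ((T ^^ n) x - x - real n *\<^sub>R D x) \<le> (real n)\<^sup>2 * M * norm (D (D x))"
proof (induction n)
  case (Suc n)
  have eq: "(T ^^ Suc n) x - x - real (Suc n) *\<^sub>R D x =
    ((T ^^ n) x - x - real n *\<^sub>R D x) + ((T ^^ n) (D x) - D x)"
    by (simp add: D_def linear_diff[OF funpow_linear] funpow_swap1 algebra_simps)
  have "norm ((T ^^ Suc n) x - x - real (Suc n) *\<^sub>R D x)
      \<le> norm ((T ^^ n) x - x - real n *\<^sub>R D x) + norm ((T ^^ n) (D x) - D x)"
    unfolding eq by (rule norm_triangle_ineq)
  also have "\<dots> \<le> (real n)\<^sup>2 * M * norm (D (D x)) + real n * M * norm (D (D x))"
    using Suc norm_funpow_diff_le[of n "D x"] by simp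
  also have "\<dots> = ((real n)\<^sup>2 + real n) * (M * norm (D (D x)))"
    by (simp add: algebra_simps)
  also have "\<dots> \<le> (real (Suc n))\<^sup>2 * (M * norm (D (D x)))"
    using bound_ge_1 by (intro mult_right_mono) (auto simp: power2_eq_square algebra_simps)
  finally show ?case by (simp add: mult_ac)
qed simp

text \<open>\<open>n\<close> times \<open>D x\<close> is the difference of
  \<open>(T ^^ n) x - x\<close>, bounded independently of \<open>n\<close>, and a Taylor remainder
  of order \<open>n\<close> squared. Taking \<open>n\<close> of the order of
  \<open>norm x / norm (D x)\<close> balances the two.\<close>

lemma landau_inequality: "(norm (D x))\<^sup>2 \<le> 12 * M\<^sup>2 * norm x * norm (D (D x))"
proof (cases "D x = 0")
  case False
  define A B E where "A = norm x" and "B = norm (D x)" and "E = norm (D (D x))"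
  have B: "B > 0" using False by (simp add: B_def)
  have AE: "A \<ge> 0" "E \<ge> 0" by (simp_all add: A_def E_def)
  have "(M + 1) * A \<le> 2 * M * A"
    using bound_ge_1 AE by (intro mult_right_mono) auto
  then have BA: "B \<le> 2 * M * A"
    using norm_D_le[of x] by (simp add: A_def B_def)
  \<comment> \<open>This \<open>n\<close> makes \<open>2 * M * A \<le> n * B / 2\<close>, so the zeroth-order term of the Taylor estimate can
    be absorbed.\<close>
  define n where "n = nat \<lceil>4 * M * A / B\<rceil>"
  \<comment> \<open>Since this quotient is at least 2, \<open>n\<close> is positive and rounding up
    costs at most a factor 3/2, which turns 4 into 6 below.\<close>
  have x0: "2 \<le> 4 * M * A / B"
    using BA B by (simp add: field_simps)
  have n_ge: "4 * M * A / B \<le> real n" unfolding n_def by linarith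
  have "real n \<le> 4 * M * A / B + 1" unfolding n_def using x0 by linarith
  also have "\<dots> \<le> 6 * M * A / B" using BA B by (simp add: field_simps)
  finally have n_le: "real n \<le> 6 * M * A / B" .
  have n0: "real n > 0" using n_ge x0 by linarith
  have "real n * B = norm (((T ^^ n) x - x) - ((T ^^ n) x - x - real n *\<^sub>R D x))"
    by (simp add: B_def)
  also have "\<dots> \<le> norm ((T ^^ n) x - x) + norm ((T ^^ n) x - x - real n *\<^sub>R D x)"
    by (rule norm_triangle_ineq4)
  also have "norm ((T ^^ n) x - x) \<le> (M + 1) * A"
    using power_bounded[of n x] norm_triangle_ineq4[of "(T ^^ n) x" x]
    by (simp add: A_def algebra_simps)
  also have "norm ((T ^^ n) x - x - real n *\<^sub>R D x) \<le> (real n)\<^sup>2 * M * E"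
    unfolding E_def by (rule norm_funpow_taylor_le)
  finally have "real n * B \<le> 2 * M * A + (real n)\<^sup>2 * M * E"
    using \<open>(M + 1) * A \<le> 2 * M * A\<close> by linarith
  moreover have "4 * M * A \<le> real n * B"
    using n_ge B by (simp add: field_simps)
  ultimately have "real n * B \<le> real n * (2 * real n * M * E)"
    by (simp add: power2_eq_square algebra_simps)
  then have "B \<le> 2 * real n * M * E" using n0 by simp
  also have "\<dots> = real n * (2 * M * E)" by simp
  also have "\<dots> \<le> 6 * M * A / B * (2 * M * E)"
    using n_le bound_ge_1 AE by (intro mult_right_mono) auto
  finally have "B * B \<le> 12 * M\<^sup>2 * A * E"
    using B by (simp add: field_simps power2_eq_square)
  then show ?thesis by (simp add: A_def B_def E_def power2_eq_square)
qed (use bound_ge_1 in simp)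

end

section \<open>Log-convex finite sequences\<close>

lemma log_convex_le_max:
  fixes w :: "nat \<Rightarrow> real"
  assumes nonneg: "\<And>k. 0 \<le> w k"
    and log_convex: "\<And>k. 0 < k \<Longrightarrow> k < l \<Longrightarrow> (w k)\<^sup>2 \<le> w (k - 1) * w (k + 1)"
    and "k \<le> l"
  shows "w k \<le> max (w 0) (w l)"
proof (rule ccontr)
  assume contr: "\<not> ?thesis"
  define m where "m = Max (w ` {..l})"
  have le: "w i \<le> m" if "i \<le> l" for i
    using that by (simp add: m_def)
  have "m \<in> w ` {..l}" unfolding m_def by (rule Max_in) auto
  then have ex: "\<exists>i. i \<le> l \<and> w i = m" by auto
  \<comment> \<open>The least index attaining the maximum has a left neighbour strictly below the
    maximum, so log-convexity at an interior \<open>i\<close> would give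
    \<open>m * m < m * m\<close>.\<close>
  define i where "i = (LEAST i. i \<le> l \<and> w i = m)"
  have i: "i \<le> l" "w i = m" using LeastI_ex[OF ex] by (auto simp: i_def)
  have less: "w 0 < m" "w l < m" using contr le[OF \<open>k \<le> l\<close>] by linarith+
  have "i \<noteq> 0" "i \<noteq> l" using less i(2) by (metis less_irrefl)+
  then have i0: "0 < i" "i < l" using i(1) by simp_all
  have "m > 0" using less nonneg[of 0] by linarith
  have "w (i - 1) \<noteq> m"
    using not_less_Least[of "i - 1" "\<lambda>i. i \<le> l \<and> w i = m"] i0 by (simp add: i_def[symmetric])
  then have "w (i - 1) < m" using le[of "i - 1"] i0 by (intro le_neq_trans) simp_all
  then have "w (i - 1) * m < m * m"
    using \<open>m > 0\<close> by (rule mult_strict_right_mono)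
  moreover have "w (i - 1) * w (i + 1) \<le> w (i - 1) * m"
    using le[of "i + 1"] i0(2) nonneg by (intro mult_left_mono) simp_all
  ultimately have "w (i - 1) * w (i + 1) < m * m" by linarith
  with log_convex[OF i0] i show False by (simp add: power2_eq_square)
qed

text \<open>Multiplying \<open>w k\<close> by \<open>K ^ k\<^sup>2 * s ^ k\<close> absorbs the constant \<open>K\<close>; the free parameter \<open>s\<close>
  balances the two end points.\<close>

lemma almost_log_convex_le:
  fixes w :: "nat \<Rightarrow> real"
  assumes nonneg: "\<And>k. 0 \<le> w k" and K: "1 \<le> K" and s: "0 < s"
    and log_convex: "\<And>k. 0 < k \<Longrightarrow> k < l \<Longrightarrow> (w k)\<^sup>2 \<le> K * (w (k - 1) * w (k + 1))"
    and "k \<le> l"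
  shows "s ^ k * w k \<le> K ^ l\<^sup>2 * (w 0 + s ^ l * w l)"
proof -
  define u where "u k = K ^ k\<^sup>2 * s ^ k * w k" for k
  have u_nonneg: "0 \<le> u k" for k using nonneg K s by (simp add: u_def)
  have u_log: "(u k)\<^sup>2 \<le> u (k - 1) * u (k + 1)" if k: "0 < k" "k < l" for k
  proof -
    obtain j where j: "k = Suc j" using k by (cases k) auto
    have "(u k)\<^sup>2 = (K ^ k\<^sup>2 * s ^ k)\<^sup>2 * (w k)\<^sup>2" by (simp add: u_def power_mult_distrib)
    also have "\<dots> \<le> (K ^ k\<^sup>2 * s ^ k)\<^sup>2 * (K * (w (k - 1) * w (k + 1)))"
      using log_convex[OF k] by (rule mult_left_mono) simp
    \<comment> \<open>\<open>K\<close> is weakened to its square so that the exponent becomes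
      \<open>2 * k\<^sup>2 + 2\<close>, the sum of the squares of \<open>k - 1\<close> and
      \<open>k + 1\<close>.\<close>
    also have "\<dots> \<le> (K ^ k\<^sup>2 * s ^ k)\<^sup>2 * (K\<^sup>2 * (w (k - 1) * w (k + 1)))"
      using K nonneg by (intro mult_left_mono mult_right_mono) (auto simp: power2_eq_square)
    also have "\<dots> = (K ^ (2 * k\<^sup>2 + 2) * s ^ (2 * k)) * (w (k - 1) * w (k + 1))"
      by (simp add: power_mult_distrib power_add mult_2) (simp add: power2_eq_square mult_ac)
    also have "2 * k\<^sup>2 + 2 = (k - 1)\<^sup>2 + (k + 1)\<^sup>2" by (simp add: j power2_eq_square)
    also have "2 * k = (k - 1) + (k + 1)" by (simp add: j)
    also have "K ^ ((k - 1)\<^sup>2 + (k + 1)\<^sup>2) * s ^ (k - 1 + (k + 1)) * (w (k - 1) * w (k + 1))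
        = u (k - 1) * u (k + 1)"
      unfolding u_def power_add by (simp add: mult_ac)
    finally show ?thesis .
  qed
  have "1 * (s ^ k * w k) \<le> u k"
    unfolding u_def mult.assoc using K nonneg s by (intro mult_right_mono one_le_power) auto
  also have "\<dots> \<le> max (u 0) (u l)" by (rule log_convex_le_max[OF u_nonneg u_log \<open>k \<le> l\<close>])
  also have "\<dots> \<le> u 0 + u l" using u_nonneg[of 0] u_nonneg[of l] by linarith
  also have "\<dots> \<le> K ^ l\<^sup>2 * w 0 + u l"
    using mult_right_mono[of 1 "K ^ l\<^sup>2" "w 0"] K nonneg by (simp add: u_def)
  finally show ?thesis by (simp add: u_def algebra_simps)
qed

section \<open>Leibniz expansion and estimates for products and inverses\<close>

lemma banach_algebra_mult_bound:
  "\<exists>C\<ge>1. \<forall>x y :: 'a::complex_banach_algebra. norm (x * y) \<le> C * norm x * norm y"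
proof -
  obtain C where C: "\<And>x y :: 'a. norm (x * y) \<le> C * norm x * norm y"
    using norm_mult_bounded by blast
  have "norm (x * y) \<le> max 1 C * norm x * norm y" for x y :: 'a
    using C[of x y] mult_right_mono[of C "max 1 C" "norm x * norm y"]
    by (simp add: mult.assoc)
  then show ?thesis by (intro exI[of _ "max 1 C"]) simp
qed

locale multiplicative_power_bounded_operator = power_bounded_operator T M
  for T :: "'a::complex_banach_algebra \<Rightarrow> 'a" and M :: real +
  fixes C :: real
  assumes mult: "T (x * y) = T x * T y" and one: "T 1 = 1"
    and C_ge_1: "1 \<le> C" and norm_mult_le: "norm ((x::'a) * y) \<le> C * norm x * norm y"
begin

lemma D_add: "D (x + y) = D x + D y"
  by (simp add: D_def linear_add[OF linear])

lemma D_funpow_add: "(D ^^ k) (x + y) = (D ^^ k) x + (D ^^ k) y"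
  by (induction k) (simp_all add: D_add)

lemma D_funpow_one: "0 < k \<Longrightarrow> (D ^^ k) 1 = 0"
proof (induction k)
  case (Suc k)
  have "D 0 = 0" by (simp add: D_def linear_0[OF linear])
  with Suc show ?case by (cases k) (auto simp: D_def one)
qed simp

text \<open>\<open>D\<close> is a twisted derivation:
  \<open>D (x * y) = D x * T y + x * D y\<close>. Every difference falling on the left factor leaves
  one \<open>T\<close> on the right factor, hence the power \<open>T ^^ i\<close>. With it the
  family of these terms is closed under \<open>D\<close>, up to sums.\<close>

definition leibniz_term :: "'a \<Rightarrow> 'a \<Rightarrow> nat \<Rightarrow> nat \<Rightarrow> 'a" where
  "leibniz_term a b i j = (D ^^ i) a * (T ^^ i) ((D ^^ j) b)"

lemma D_leibniz_term:
  "D (leibniz_term a b i j) = leibniz_term a b (Suc i) j + leibniz_term a b i (Suc j)"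
  by (simp add: leibniz_term_def funpow_commute) (simp add: D_def mult algebra_simps)

lemma D_funpow_leibniz_term_Suc:
  "(D ^^ Suc n) (leibniz_term a b i j) =
    (D ^^ n) (leibniz_term a b (Suc i) j) + (D ^^ n) (leibniz_term a b i (Suc j))"
  by (simp only: funpow_Suc_right o_apply D_leibniz_term D_funpow_add)

text \<open>Each application of \<open>D\<close> doubles the number of terms. Counting all
  \<open>2 ^ n\<close> of them separately avoids binomial coefficients.\<close>

lemma norm_D_funpow_leibniz_term_le:
  assumes "\<And>k. k \<le> n \<Longrightarrow> norm (leibniz_term a b (i + k) (j + n - k)) \<le> B"
  shows "norm ((D ^^ n) (leibniz_term a b i j)) \<le> 2 ^ n * B"
  using assms
proof (induction n arbitrary: i j)
  case (Suc n)
  have "norm ((D ^^ n) (leibniz_term a b (Suc i) j)) \<le> 2 ^ n * B"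
    using Suc.prems[of "Suc k" for k] by (intro Suc.IH) simp
  moreover have "norm ((D ^^ n) (leibniz_term a b i (Suc j))) \<le> 2 ^ n * B"
    using Suc.prems by (intro Suc.IH) simp
  ultimately show ?case
    using norm_triangle_ineq[of "(D ^^ n) (leibniz_term a b (Suc i) j)"
        "(D ^^ n) (leibniz_term a b i (Suc j))"]
    unfolding D_funpow_leibniz_term_Suc by simp
qed (use assms in force)

text \<open>The same expansion with one summand removed, namely the one in which all differences
  fall on the second factor; it is the term to be isolated when inverses are estimated.\<close>

lemma norm_D_funpow_leibniz_term_diff_le:
  assumes "\<And>k. 0 < k \<Longrightarrow> k \<le> n \<Longrightarrow> norm (leibniz_term a b (i + k) (j + n - k)) \<le> B" "0 \<le> B"
  shows "norm ((D ^^ n) (leibniz_term a b i j) - leibniz_term a b i (j + n)) \<le> 2 ^ n * B"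
  using assms
proof (induction n arbitrary: i j)
  case (Suc n)
  have "norm ((D ^^ n) (leibniz_term a b (Suc i) j)) \<le> 2 ^ n * B"
    using Suc.prems(1)[of "Suc k" for k]
    by (intro norm_D_funpow_leibniz_term_le) simp
  moreover have "norm ((D ^^ n) (leibniz_term a b i (Suc j)) - leibniz_term a b i (Suc j + n))
      \<le> 2 ^ n * B"
    using Suc.prems by (intro Suc.IH) simp_all
  ultimately show ?case
    using norm_triangle_ineq[of "(D ^^ n) (leibniz_term a b (Suc i) j)"
        "(D ^^ n) (leibniz_term a b i (Suc j)) - leibniz_term a b i (Suc j + n)"]
    unfolding D_funpow_leibniz_term_Suc by (simp add: algebra_simps)
qed simp

lemma norm_leibniz_term_le:
  "norm (leibniz_term a b i j) \<le> C * M * (norm ((D ^^ i) a) * norm ((D ^^ j) b))"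
proof -
  have "norm (leibniz_term a b i j) \<le> C * norm ((D ^^ i) a) * norm ((T ^^ i) ((D ^^ j) b))"
    unfolding leibniz_term_def by (rule norm_mult_le)
  also have "\<dots> \<le> C * norm ((D ^^ i) a) * (M * norm ((D ^^ j) b))"
    using C_ge_1 by (intro mult_left_mono power_bounded) auto
  finally show ?thesis by (simp add: mult_ac)
qed

lemma norm_D_funpow_log_convex:
  assumes "0 < k"
  shows "(norm ((D ^^ k) a))\<^sup>2
    \<le> 12 * M\<^sup>2 * (norm ((D ^^ (k - 1)) a) * norm ((D ^^ (k + 1)) a))"
  using landau_inequality[of "(D ^^ (k - 1)) a"] assms by (cases k) (auto simp: mult_ac)

text \<open>Both factors are log-convex in \<open>k\<close> up to \<open>12 * M\<^sup>2\<close>, so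
  their product is so up to the square of that constant. The parameter \<open>s\<close> stays free:
  products use \<open>s = 1\<close>, inverses a large \<open>s\<close>.\<close>

lemma norm_D_funpow_mult_le:
  fixes l :: nat
  defines "K \<equiv> (12 * M\<^sup>2)\<^sup>2"
  assumes "k \<le> l" "0 < s"
  shows "s ^ k * (norm ((D ^^ k) a) * norm ((D ^^ (l - k)) b))
    \<le> K ^ l\<^sup>2 * (norm a * norm ((D ^^ l) b) + s ^ l * (norm ((D ^^ l) a) * norm b))"
proof -
  define w where "w k = norm ((D ^^ k) a) * norm ((D ^^ (l - k)) b)" for k
  have M: "1 \<le> M\<^sup>2" using bound_ge_1 by (simp add: one_le_power)
  have "s ^ k * w k \<le> K ^ l\<^sup>2 * (w 0 + s ^ l * w l)"
  proof (rule almost_log_convex_le)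
    show "1 \<le> K" unfolding K_def using M by (intro one_le_power) simp
    fix k assume k: "0 < k" "k < l"
    have "(w k)\<^sup>2 = (norm ((D ^^ k) a))\<^sup>2 * (norm ((D ^^ (l - k)) b))\<^sup>2"
      by (simp add: w_def power_mult_distrib)
    also have "\<dots> \<le> (12 * M\<^sup>2 * (norm ((D ^^ (k - 1)) a) * norm ((D ^^ (k + 1)) a))) *
        (12 * M\<^sup>2 * (norm ((D ^^ (l - k - 1)) b) * norm ((D ^^ (l - k + 1)) b)))"
      using k by (intro mult_mono norm_D_funpow_log_convex) auto
    also have "\<dots> = K * (w (k - 1) * w (k + 1))"
      using k by (simp add: w_def K_def power2_eq_square mult_ac Suc_diff_le)
    finally show "(w k)\<^sup>2 \<le> K * (w (k - 1) * w (k + 1))" .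
  qed (use assms in \<open>auto simp: w_def\<close>)
  then show ?thesis by (simp add: w_def)
qed

lemma norm_D_funpow_product_le:
  "norm ((D ^^ l) (a * b)) \<le> 2 ^ l * (C * M * ((12 * M\<^sup>2)\<^sup>2) ^ l\<^sup>2) *
    (norm a * norm ((D ^^ l) b) + norm b * norm ((D ^^ l) a))" (is "_ \<le> _ * ?R")
proof -
  have CM: "0 \<le> C * M" using C_ge_1 bound_ge_1 by simp
  have "norm ((D ^^ l) (leibniz_term a b 0 0)) \<le> 2 ^ l * (C * M * (((12 * M\<^sup>2)\<^sup>2) ^ l\<^sup>2 * ?R))"
  proof (rule norm_D_funpow_leibniz_term_le)
    fix k assume "k \<le> l"
    have "norm (leibniz_term a b k (l - k))
        \<le> C * M * (norm ((D ^^ k) a) * norm ((D ^^ (l - k)) b))"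
      by (rule norm_leibniz_term_le)
    also have "\<dots> \<le> C * M * (((12 * M\<^sup>2)\<^sup>2) ^ l\<^sup>2 * ?R)"
      using norm_D_funpow_mult_le[OF \<open>k \<le> l\<close>, of 1 a b] CM
      by (intro mult_left_mono) (simp_all add: mult_ac)
    finally show "norm (leibniz_term a b (0 + k) (0 + l - k))
        \<le> C * M * (((12 * M\<^sup>2)\<^sup>2) ^ l\<^sup>2 * ?R)" by simp
  qed
  then show ?thesis by (simp add: leibniz_term_def mult_ac)
qed

text \<open>As \<open>(D ^^ l) 1 = 0\<close>, the summand \<open>a * (D ^^ l) c\<close> is minus the
  sum of all others, and multiplying by \<open>c\<close> from the left recovers
  \<open>(D ^^ l) c\<close>. The bound for the others contains \<open>norm ((D ^^ l) c)\<close>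
  again, but with a factor \<open>1 / s\<close> that makes it absorbable.\<close>

lemma norm_D_funpow_inverse_le:
  fixes a c :: 'a and l :: nat
  defines "Q \<equiv> C * norm c * (2 ^ l * (C * M * ((12 * M\<^sup>2)\<^sup>2) ^ l\<^sup>2))"
  assumes ac: "a * c = 1" "c * a = 1" and "0 < l"
  shows "norm ((D ^^ l) c) \<le> 2 * Q * (2 * Q * norm a + 1) ^ l * norm c * norm ((D ^^ l) a)"
proof -
  define X Y where "X = norm ((D ^^ l) c)" and "Y = norm ((D ^^ l) a)"
  define K where "K = ((12 * M\<^sup>2)\<^sup>2) ^ l\<^sup>2"
  have K0: "0 \<le> K" by (simp add: K_def)
  have CM: "0 \<le> C * M" using C_ge_1 bound_ge_1 by simp
  have XY: "0 \<le> X" "0 \<le> Y" by (simp_all add: X_def Y_def)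
  have Q0: "0 \<le> Q" using CM C_ge_1 by (simp add: Q_def)
  \<comment> \<open>With this \<open>s\<close> the term of \<open>Q * R\<close> containing \<open>X\<close> is at most \<open>X / 2\<close> and can be absorbed.\<close>
  define s where "s = 2 * Q * norm a + 1"
  have s1: "1 \<le> s" using Q0 by (simp add: s_def)
  define R where "R = norm a * X / s + s ^ l * (Y * norm c)"
  have R0: "0 \<le> R" using s1 XY by (simp add: R_def)
  have "norm ((D ^^ l) (leibniz_term a c 0 0) - leibniz_term a c 0 (0 + l))
      \<le> 2 ^ l * (C * M * (K * R))"
  proof (rule norm_D_funpow_leibniz_term_diff_le)
    fix k assume k: "0 < k" "k \<le> l"
    define v where "v = norm ((D ^^ k) a) * norm ((D ^^ (l - k)) c)"
    have v0: "0 \<le> v" by (simp add: v_def)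
    have "s ^ k * v \<le> K * (norm a * X + s ^ l * (Y * norm c))"
      using norm_D_funpow_mult_le[OF k(2), of s a c] s1 by (simp add: v_def X_def Y_def K_def)
    then have "v \<le> K * (norm a * X + s ^ l * (Y * norm c)) / s ^ k"
      using s1 by (simp add: field_simps)
    also have "\<dots> = K * (norm a * X / s ^ k + s ^ l * (Y * norm c) / s ^ k)"
      by (simp only: add_divide_distrib[symmetric] times_divide_eq_right)
    \<comment> \<open>Here \<open>0 < k\<close> matters: \<open>s ^ k\<close> is at least
      \<open>s\<close> in the first summand, while in the second it is only bounded below by
      1.\<close>
    also have "\<dots> \<le> K * (norm a * X / s ^ 1 + s ^ l * (Y * norm c) / 1)"
      using s1 XY K0 k
      by (intro mult_left_mono add_mono divide_left_mono power_increasing one_le_power) auto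
    finally have "v \<le> K * R" by (simp add: R_def)
    then have "C * M * v \<le> C * M * (K * R)" using CM by (rule mult_left_mono)
    then show "norm (leibniz_term a c (0 + k) (0 + l - k)) \<le> C * M * (K * R)"
      using norm_leibniz_term_le[of a c k "l - k"] by (simp add: v_def)
  qed (use CM K0 R0 in simp)
  then have small: "norm (a * (D ^^ l) c) \<le> 2 ^ l * (C * M * (K * R))"
    using D_funpow_one[OF \<open>0 < l\<close>] by (simp add: leibniz_term_def ac)
  have "(D ^^ l) c = c * (a * (D ^^ l) c)" using ac by (simp add: mult.assoc[symmetric])
  then have "X \<le> C * norm c * norm (a * (D ^^ l) c)"
    unfolding X_def by (metis norm_mult_le)
  also have "\<dots> \<le> C * norm c * (2 ^ l * (C * M * (K * R)))"
    using small C_ge_1 by (intro mult_left_mono) auto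
  also have "\<dots> = Q * R" by (simp add: Q_def K_def mult_ac)
  also have "\<dots> = Q * norm a / s * X + Q * (s ^ l * (Y * norm c))"
    by (simp add: R_def algebra_simps)
  also have "Q * norm a / s * X \<le> 1 / 2 * X"
    using XY s1 by (intro mult_right_mono) (auto simp: s_def field_simps)
  finally have "X \<le> 2 * (Q * (s ^ l * (Y * norm c)))" by simp
  then show ?thesis by (simp add: X_def Y_def s_def mult_ac)
qed

end

section \<open>Weighted Lp norms on the half-line\<close>

text \<open>The extended norm of the Lp space on the positive half-line for the measure dh/h, in the
  shape of \<open>besov_seminorm\<close> so that unfolding identifies the two. The infinite case is
  split off because \<open>enn2real\<close> sends infinity to 0.\<close>

definition lp_gauge :: "ennreal \<Rightarrow> (real \<Rightarrow> real) \<Rightarrow> ennreal" where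
  "lp_gauge p f =
     (if p = \<infinity> then SUP h \<in> {0<..}. ennreal (f h)
      else if (\<integral>\<^sup>+ h \<in> {0<..}. ennreal (f h powr enn2real p / h) \<partial>lborel) = \<infinity> then \<infinity>
      else ennreal (enn2real (\<integral>\<^sup>+ h \<in> {0<..}. ennreal (f h powr enn2real p / h) \<partial>lborel)
        powr (1 / enn2real p)))"

lemma lp_gauge_cong:
  assumes "\<And>h. 0 < h \<Longrightarrow> f h = g h"
  shows "lp_gauge p f = lp_gauge p g"
proof -
  have "(\<integral>\<^sup>+ h \<in> {0<..}. ennreal (f h powr q / h) \<partial>lborel) =
      (\<integral>\<^sup>+ h \<in> {0<..}. ennreal (g h powr q / h) \<partial>lborel)" for q
    by (rule nn_integral_cong) (auto simp: assms indicator_def)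
  then show ?thesis
    unfolding lp_gauge_def using assms by (auto intro!: SUP_cong)
qed

lemma one_le_enn2real: "1 \<le> p \<Longrightarrow> p \<noteq> \<infinity> \<Longrightarrow> 1 \<le> enn2real p"
  using enn2real_mono[of 1 p] by (simp add: less_top)

lemma lp_gauge_infinity_le_iff:
  assumes "0 \<le> e"
  shows "lp_gauge top f \<le> ennreal e \<longleftrightarrow> (\<forall>h>0. f h \<le> e)"
  using assms by (auto simp: lp_gauge_def SUP_le_iff ennreal_le_iff)

text \<open>Finite bounds on the gauge become bounds on the integral itself, which removes the root
  and the case distinction from all later estimates.\<close>

lemma lp_gauge_le_iff:
  assumes "1 \<le> p" "p \<noteq> \<infinity>" "0 \<le> e"
  shows "lp_gauge p f \<le> ennreal e \<longleftrightarrow>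
    (\<integral>\<^sup>+ h \<in> {0<..}. ennreal (f h powr enn2real p / h) \<partial>lborel) \<le> ennreal (e powr enn2real p)"
    (is "_ \<longleftrightarrow> ?I \<le> _")
proof -
  define q where "q = enn2real p"
  have q: "1 \<le> q" using one_le_enn2real assms by (simp add: q_def)
  show ?thesis
  proof (cases ?I)
    case (real i)
    have "i powr (1 / q) \<le> e \<longleftrightarrow> i \<le> e powr q"
    proof
      assume "i powr (1 / q) \<le> e"
      then have "(i powr (1 / q)) powr q \<le> e powr q" using q by (intro powr_mono2) auto
      then show "i \<le> e powr q" using q real by (simp add: powr_powr)
    next
      assume "i \<le> e powr q"
      then have "i powr (1 / q) \<le> (e powr q) powr (1 / q)"
        using q real by (intro powr_mono2) auto
      then show "i powr (1 / q) \<le> e" using q assms by (simp add: powr_powr)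
    qed
    then show ?thesis using real assms by (simp add: lp_gauge_def q_def ennreal_le_iff)
  next
    case top
    then show ?thesis using assms by (simp add: lp_gauge_def top_unique)
  qed
qed

lemma lp_gauge_scale_le:
  assumes p: "1 \<le> p" and [measurable]: "f \<in> borel_measurable borel"
    and f: "lp_gauge p f \<le> ennreal e" "\<And>h. 0 < h \<Longrightarrow> 0 \<le> f h"
    and g: "\<And>h. 0 < h \<Longrightarrow> 0 \<le> g h" "\<And>h. 0 < h \<Longrightarrow> g h \<le> c * f h"
    and c: "0 \<le> c" and e: "0 \<le> e"
  shows "lp_gauge p g \<le> ennreal (c * e)"
proof (cases "p = \<infinity>")
  case True
  then have "\<forall>h>0. f h \<le> e" using f e by (simp add: lp_gauge_infinity_le_iff)
  then have "\<forall>h>0. g h \<le> c * e"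
    using g(2) c by (meson mult_left_mono order_trans)
  then show ?thesis using True c e by (simp add: lp_gauge_infinity_le_iff)
next
  case False
  define q where "q = enn2real p"
  have q: "1 \<le> q" using one_le_enn2real p False by (simp add: q_def)
  have "(\<integral>\<^sup>+ h \<in> {0<..}. ennreal (g h powr q / h) \<partial>lborel)
      \<le> (\<integral>\<^sup>+ h. ennreal (c powr q) * (ennreal (f h powr q / h) * indicator {0<..} h) \<partial>lborel)"
  proof (rule nn_integral_mono)
    fix h :: real
    have "g h powr q / h \<le> c powr q * (f h powr q / h)" if "0 < h"
    proof -
      have "g h powr q \<le> (c * f h) powr q" using q g that by (intro powr_mono2) auto
      also have "\<dots> = c powr q * f h powr q" using c f that by (simp add: powr_mult)
      finally show ?thesis using that by (simp add: field_simps)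
    qed
    then show "ennreal (g h powr q / h) * indicator {0<..} h
        \<le> ennreal (c powr q) * (ennreal (f h powr q / h) * indicator {0<..} h)"
      by (auto simp: indicator_def ennreal_mult''[symmetric] intro!: ennreal_leI)
  qed
  also have "\<dots> = ennreal (c powr q) *
      (\<integral>\<^sup>+ h \<in> {0<..}. ennreal (f h powr q / h) \<partial>lborel)"
    by (rule nn_integral_cmult) measurable
  also have "\<dots> \<le> ennreal (c powr q) * ennreal (e powr q)"
    using f(1) p False e by (intro mult_left_mono) (auto simp: lp_gauge_le_iff q_def)
  also have "\<dots> = ennreal ((c * e) powr q)"
    using c e by (simp add: powr_mult ennreal_mult)
  finally show ?thesis using p False c e by (simp add: lp_gauge_le_iff q_def)
qed

text \<open>For positive \<open>x\<close> and \<open>y\<close> this is convexity of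
  \<open>powr q\<close>. If one of them is 0, it reduces to \<open>v powr q \<le> v\<close> on the
  unit interval.\<close>

lemma powr_convex_combination_le:
  fixes x y u q :: real
  assumes q: "1 \<le> q" and xy: "0 \<le> x" "0 \<le> y" and u: "0 \<le> u" "u \<le> 1"
  shows "(u * x + (1 - u) * y) powr q \<le> u * x powr q + (1 - u) * y powr q"
proof -
  have powr_le: "v powr q \<le> v" if "0 \<le> v" "v \<le> 1" for v :: real
    using powr_mono'[of 1 q v] that q by simp
  have zero: "(v * z) powr q \<le> v * z powr q" if "0 \<le> v" "v \<le> 1" "0 \<le> z" for v z :: real
    using powr_le[of v] that by (simp add: powr_mult mult_right_mono)
  show ?thesis
  proof (cases "x = 0 \<or> y = 0")
    case True
    then show ?thesis using zero[of u x] zero[of "1 - u" y] u xy by auto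
  next
    case False
    then have "0 < x" "0 < y" using xy by auto
    then show ?thesis
      using convex_onD[OF powr_convex[OF q], of "1 - u" x y] u by simp
  qed
qed

text \<open>Minkowski's inequality by convexity of \<open>powr q\<close>, applied to
  \<open>(f + g) / (\<alpha> + \<beta>)\<close> as a convex combination of \<open>f / \<alpha>\<close> and \<open>g / \<beta>\<close>.\<close>

lemma lp_gauge_add_le_pos:
  assumes p: "1 \<le> p"
    and [measurable]: "f \<in> borel_measurable borel" "g \<in> borel_measurable borel"
    and f: "lp_gauge p f \<le> ennreal \<alpha>" "\<And>h. 0 < h \<Longrightarrow> 0 \<le> f h" "0 < \<alpha>"
    and g: "lp_gauge p g \<le> ennreal \<beta>" "\<And>h. 0 < h \<Longrightarrow> 0 \<le> g h" "0 < \<beta>"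
    and v: "\<And>h. 0 < h \<Longrightarrow> 0 \<le> v h" "\<And>h. 0 < h \<Longrightarrow> v h \<le> f h + g h"
  shows "lp_gauge p v \<le> ennreal (\<alpha> + \<beta>)"
proof (cases "p = \<infinity>")
  case True
  then have "\<forall>h>0. f h \<le> \<alpha>" "\<forall>h>0. g h \<le> \<beta>"
    using f g by (simp_all add: lp_gauge_infinity_le_iff)
  then have "\<forall>h>0. v h \<le> \<alpha> + \<beta>" using v(2) by (meson add_mono order_trans)
  then show ?thesis
    using True f g by (simp add: lp_gauge_infinity_le_iff del: ennreal_plus)
next
  case False
  define q where "q = enn2real p"
  have q: "1 \<le> q" using one_le_enn2real p False by (simp add: q_def)
  define u where "u = \<alpha> / (\<alpha> + \<beta>)"
  have u: "0 \<le> u" "u \<le> 1" and u': "1 - u = \<beta> / (\<alpha> + \<beta>)"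
    using f(3) g(3) by (auto simp: u_def field_simps)
  \<comment> \<open>The coefficients of \<open>f h powr q\<close> and \<open>g h powr q\<close>
    after convexity is applied. They satisfy \<open>A * \<alpha> powr q + B * \<beta> powr q =
    (\<alpha> + \<beta>) powr q\<close>.\<close>
  define A B where "A = (\<alpha> + \<beta>) powr q * u / \<alpha> powr q"
    and "B = (\<alpha> + \<beta>) powr q * (1 - u) / \<beta> powr q"
  have AB: "0 \<le> A" "0 \<le> B" using u by (simp_all add: A_def B_def)
  have pointwise: "v h powr q / h \<le> A * (f h powr q / h) + B * (g h powr q / h)" if "0 < h" for h
  proof -
    have fg: "0 \<le> f h" "0 \<le> g h" using f g that by auto
    have eq: "f h + g h = (\<alpha> + \<beta>) * (u * (f h / \<alpha>) + (1 - u) * (g h / \<beta>))"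
    proof -
      have "(\<alpha> + \<beta>) * u = \<alpha>" "(\<alpha> + \<beta>) * (1 - u) = \<beta>"
        unfolding u' using f(3) g(3) by (simp_all add: u_def)
      then show ?thesis
        using f(3) g(3) by (simp only: distrib_left mult.assoc[symmetric]) simp
    qed
    have "v h powr q \<le> (f h + g h) powr q" using q v that by (intro powr_mono2) auto
    also have "\<dots> = (\<alpha> + \<beta>) powr q * (u * (f h / \<alpha>) + (1 - u) * (g h / \<beta>)) powr q"
      unfolding eq using f(3) g(3) u fg by (subst powr_mult) auto
    also have "\<dots> \<le> (\<alpha> + \<beta>) powr q * (u * (f h / \<alpha>) powr q + (1 - u) * (g h / \<beta>) powr q)"
      using f(3) g(3) u q fg by (intro mult_left_mono powr_convex_combination_le) auto
    also have "\<dots> = A * f h powr q + B * g h powr q"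
      using f(3) g(3) fg by (simp add: A_def B_def powr_divide algebra_simps)
    finally show ?thesis using that by (simp add: field_simps)
  qed
  have "(\<integral>\<^sup>+ h \<in> {0<..}. ennreal (v h powr q / h) \<partial>lborel)
      \<le> (\<integral>\<^sup>+ h. ennreal A * (ennreal (f h powr q / h) * indicator {0<..} h) +
          ennreal B * (ennreal (g h powr q / h) * indicator {0<..} h) \<partial>lborel)"
    using pointwise AB
    by (intro nn_integral_mono)
      (auto simp: indicator_def ennreal_mult''[symmetric] ennreal_plus[symmetric]
        intro!: ennreal_leI simp del: ennreal_plus)
  also have "\<dots> = ennreal A * (\<integral>\<^sup>+ h \<in> {0<..}. ennreal (f h powr q / h) \<partial>lborel) +
      ennreal B * (\<integral>\<^sup>+ h \<in> {0<..}. ennreal (g h powr q / h) \<partial>lborel)"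
    by (simp add: nn_integral_add nn_integral_cmult)
  also have "\<dots> \<le> ennreal A * ennreal (\<alpha> powr q) + ennreal B * ennreal (\<beta> powr q)"
    using f g p False by (intro add_mono mult_left_mono) (auto simp: lp_gauge_le_iff q_def)
  also have "\<dots> = ennreal (A * \<alpha> powr q + B * \<beta> powr q)"
    using AB by (simp add: ennreal_mult)
  also have "A * \<alpha> powr q + B * \<beta> powr q = (\<alpha> + \<beta>) powr q"
    using f(3) g(3) by (simp add: A_def B_def distrib_left[symmetric])
  finally show ?thesis
    using p False f(3) g(3) by (simp add: lp_gauge_le_iff q_def del: ennreal_plus)
qed

text \<open>The positive case divides by both bounds, so vanishing bounds are reached by enlarging
  each by \<open>e / 2\<close> and letting \<open>e\<close> tend to 0.\<close>

lemma lp_gauge_add_le: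
  assumes p: "1 \<le> p"
    and meas: "f \<in> borel_measurable borel" "g \<in> borel_measurable borel"
    and f: "lp_gauge p f \<le> ennreal \<alpha>" "\<And>h. 0 < h \<Longrightarrow> 0 \<le> f h" "0 \<le> \<alpha>"
    and g: "lp_gauge p g \<le> ennreal \<beta>" "\<And>h. 0 < h \<Longrightarrow> 0 \<le> g h" "0 \<le> \<beta>"
    and v: "\<And>h. 0 < h \<Longrightarrow> 0 \<le> v h" "\<And>h. 0 < h \<Longrightarrow> v h \<le> f h + g h"
  shows "lp_gauge p v \<le> ennreal (\<alpha> + \<beta>)"
proof (rule ennreal_le_epsilon)
  fix e :: real assume e: "0 < e"
  have "lp_gauge p v \<le> ennreal ((\<alpha> + e / 2) + (\<beta> + e / 2))"
  proof (rule lp_gauge_add_le_pos[OF p meas])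
    show "lp_gauge p f \<le> ennreal (\<alpha> + e / 2)"
      using e by (intro order_trans[OF f(1)] ennreal_leI) simp
    show "lp_gauge p g \<le> ennreal (\<beta> + e / 2)"
      using e by (intro order_trans[OF g(1)] ennreal_leI) simp
  qed (use f g v e in auto)
  also have "\<dots> = ennreal (\<alpha> + \<beta>) + ennreal e"
    using e f(3) g(3) by (simp add: ennreal_plus[symmetric] algebra_simps del: ennreal_plus)
  finally show "lp_gauge p v \<le> ennreal (\<alpha> + \<beta>) + ennreal e" .
qed

text \<open>Lower semicontinuity under pointwise convergence: Fatou's lemma for finite
  \<open>p\<close>, passage to the limit in the pointwise bounds for infinite \<open>p\<close>.
  Completeness rests on it.\<close>

lemma lp_gauge_lim_le:
  assumes p: "1 \<le> p" and [measurable]: "\<And>n. F n \<in> borel_measurable borel"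
    and F: "\<And>n h. 0 < h \<Longrightarrow> 0 \<le> F n h" "\<And>n::nat. lp_gauge p (F n) \<le> ennreal e"
    and lim: "\<And>h. 0 < h \<Longrightarrow> (\<lambda>n. F n h) \<longlonglongrightarrow> f h" and e: "0 \<le> e"
  shows "lp_gauge p f \<le> ennreal e"
proof (cases "p = \<infinity>")
  case True
  then have "\<forall>h>0. F n h \<le> e" for n using F(2)[of n] e by (simp add: lp_gauge_infinity_le_iff)
  then have "\<forall>h>0. f h \<le> e" using lim by (meson LIMSEQ_le_const2)
  then show ?thesis using True e by (simp add: lp_gauge_infinity_le_iff)
next
  case False
  define q where "q = enn2real p"
  have q: "1 \<le> q" using one_le_enn2real p False by (simp add: q_def)
  let ?G = "\<lambda>n h. ennreal (F n h powr q / h) * indicator {0<..} h"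
  have "(\<integral>\<^sup>+ h \<in> {0<..}. ennreal (f h powr q / h) \<partial>lborel)
      = (\<integral>\<^sup>+ h. liminf (\<lambda>n. ?G n h) \<partial>lborel)"
  proof (rule nn_integral_cong)
    fix h :: real
    have "(\<lambda>n. ?G n h) \<longlonglongrightarrow> ennreal (f h powr q / h) * indicator {0<..} h"
    proof (cases "0 < h")
      case True
      then have "(\<lambda>n. F n h powr q / h) \<longlonglongrightarrow> f h powr q / h"
        using lim[OF True] F(1) q by (intro tendsto_intros tendsto_powr2) auto
      then show ?thesis using True by (simp add: tendsto_ennrealI)
    qed simp
    then show "ennreal (f h powr q / h) * indicator {0<..} h = liminf (\<lambda>n. ?G n h)"
      by (intro lim_imp_Liminf[symmetric]) simp_all
  qed
  also have "\<dots> \<le> liminf (\<lambda>n. \<integral>\<^sup>+ h. ?G n h \<partial>lborel)"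
    by (rule nn_integral_liminf) measurable
  also have "\<dots> \<le> liminf (\<lambda>n. ennreal (e powr q))"
    using F(2) p False e by (intro Liminf_mono always_eventually) (simp add: lp_gauge_le_iff q_def)
  also have "\<dots> = ennreal (e powr q)" by (simp add: Liminf_const)
  finally show ?thesis using p False e by (simp add: lp_gauge_le_iff q_def)
qed

section \<open>Moduli of smoothness\<close>

text \<open>One pair \<open>M\<close>, \<open>C\<close> serves all \<open>t\<close>, so the operator
  estimates survive the supremum over \<open>t\<close>. The group law is absorbed into the power
  bound.\<close>

locale bounded_automorphism_group =
  fixes \<psi> :: "real ^ 'd \<Rightarrow> 'a::complex_banach_algebra \<Rightarrow> 'a" and M C :: real
  assumes operator: "multiplicative_power_bounded_operator (\<psi> t) M C"
    and psi_scaleC: "\<psi> t (c *\<^sub>C x) = c *\<^sub>C \<psi> t x"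
begin

sublocale op: multiplicative_power_bounded_operator "\<psi> t" M C for t
  by (rule operator)

lemma difference_op_eq: "difference_op \<psi> t = op.D t"
  by (simp add: fun_eq_iff difference_op_def op.D_def)

lemma norm_le_modulus:
  assumes "(\<Sum>j\<in>UNIV. \<bar>t $ j\<bar>) \<le> h"
  shows "norm ((op.D t ^^ k) a) \<le> modulus_of_smoothness \<psi> k h a"
  unfolding modulus_of_smoothness_def difference_op_eq
proof (rule cSUP_upper)
  show "bdd_above ((\<lambda>t. norm ((op.D t ^^ k) a)) ` {t. (\<Sum>j\<in>UNIV. \<bar>t $ j\<bar>) \<le> h})"
    by (rule bdd_aboveI2) (rule op.norm_D_funpow_le)
qed (use assms in simp)

lemma modulus_le:
  assumes "0 < h" "\<And>t. (\<Sum>j\<in>UNIV. \<bar>t $ j\<bar>) \<le> h \<Longrightarrow> norm ((op.D t ^^ k) a) \<le> B"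
  shows "modulus_of_smoothness \<psi> k h a \<le> B"
proof -
  have "0 \<in> {t :: real ^ 'd. (\<Sum>j\<in>UNIV. \<bar>t $ j\<bar>) \<le> h}" using assms(1) by simp
  then have "{t :: real ^ 'd. (\<Sum>j\<in>UNIV. \<bar>t $ j\<bar>) \<le> h} \<noteq> {}" by blast
  then show ?thesis
    unfolding modulus_of_smoothness_def difference_op_eq
    by (rule cSUP_least) (use assms(2) in simp)
qed

lemma modulus_nonneg: "0 < h \<Longrightarrow> 0 \<le> modulus_of_smoothness \<psi> k h a"
  using norm_le_modulus[of 0 h k a] norm_ge_zero[of "(op.D 0 ^^ k) a"]
  by (simp del: norm_ge_zero)

lemma modulus_mono:
  "0 < h \<Longrightarrow> h \<le> h' \<Longrightarrow> modulus_of_smoothness \<psi> k h a \<le> modulus_of_smoothness \<psi> k h' a"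
  by (intro modulus_le norm_le_modulus) auto

lemma modulus_le_norm:
  "0 < h \<Longrightarrow> modulus_of_smoothness \<psi> k h a \<le> (M + 1) ^ k * norm a"
  by (intro modulus_le op.norm_D_funpow_le)

lemma modulus_add_le:
  assumes "0 < h"
  shows "modulus_of_smoothness \<psi> k h (a + b)
    \<le> modulus_of_smoothness \<psi> k h a + modulus_of_smoothness \<psi> k h b"
  using assms
  by (intro modulus_le)
    (auto simp: op.D_funpow_add intro!: norm_triangle_mono norm_le_modulus)

lemma D_funpow_scaleC: "(op.D t ^^ k) (c *\<^sub>C a) = c *\<^sub>C (op.D t ^^ k) a"
proof (induction k)
  case (Suc k)
  have "c *\<^sub>C (x - y) = c *\<^sub>C x - c *\<^sub>C y" for x y :: 'a
    using scaleC_add_right[of c "x - y" y] by simp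
  with Suc show ?case by (simp add: op.D_def psi_scaleC)
qed simp

lemma modulus_scaleC_le:
  assumes "0 < h"
  shows "modulus_of_smoothness \<psi> k h (c *\<^sub>C a) \<le> cmod c * modulus_of_smoothness \<psi> k h a"
  using assms
  by (intro modulus_le)
    (auto simp: D_funpow_scaleC norm_scaleC intro!: mult_left_mono norm_le_modulus)

lemma modulus_one: "0 < k \<Longrightarrow> 0 < h \<Longrightarrow> modulus_of_smoothness \<psi> k h 1 \<le> 0"
  by (intro modulus_le) (simp_all add: op.D_funpow_one)

lemma modulus_mult_le:
  "\<exists>K\<ge>0. \<forall>a b. \<forall>h>0. modulus_of_smoothness \<psi> k h (a * b) \<le>
    K * (norm a * modulus_of_smoothness \<psi> k h b + norm b * modulus_of_smoothness \<psi> k h a)"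
proof (intro exI conjI allI impI)
  let ?K = "2 ^ k * (C * M * ((12 * M\<^sup>2)\<^sup>2) ^ k\<^sup>2)"
  show K: "0 \<le> ?K" using op.C_ge_1 op.bound_ge_1 by simp
  fix a b and h :: real assume "0 < h"
  then show "modulus_of_smoothness \<psi> k h (a * b) \<le>
      ?K * (norm a * modulus_of_smoothness \<psi> k h b + norm b * modulus_of_smoothness \<psi> k h a)"
    using K
    by (intro modulus_le order_trans[OF op.norm_D_funpow_product_le] mult_left_mono add_mono
        norm_le_modulus) auto
qed

text \<open>\<open>K\<close> may depend on \<open>a\<close> and \<open>c\<close> but not on
  \<open>h\<close>; that suffices for inverse-closedness, which asks for membership only.\<close>

lemma modulus_inverse_le:
  assumes "a * c = 1" "c * a = 1" "0 < k"
  shows "\<exists>K\<ge>0. \<forall>h>0. modulus_of_smoothness \<psi> k h c \<le> K * modulus_of_smoothness \<psi> k h a"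
proof (intro exI conjI allI impI)
  let ?Q = "C * norm c * (2 ^ k * (C * M * ((12 * M\<^sup>2)\<^sup>2) ^ k\<^sup>2))"
  let ?K = "2 * ?Q * (2 * ?Q * norm a + 1) ^ k * norm c"
  show K: "0 \<le> ?K" using op.C_ge_1 op.bound_ge_1 by simp
  fix h :: real assume "0 < h"
  then show "modulus_of_smoothness \<psi> k h c \<le> ?K * modulus_of_smoothness \<psi> k h a"
    using K
    by (intro modulus_le order_trans[OF op.norm_D_funpow_inverse_le[OF assms]] mult_left_mono
        norm_le_modulus) auto
qed

text \<open>The cut-off at \<open>0\<close> makes the modulus, a supremum over the empty set for \<open>h < 0\<close>, monotone on
  the whole line and hence measurable.\<close>

definition profile :: "real \<Rightarrow> 'a \<Rightarrow> real \<Rightarrow> real" where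
  "profile r a h =
    h powr (-r) * (if 0 < h then modulus_of_smoothness \<psi> (nat \<lfloor>r\<rfloor> + 1) h a else 0)"

lemma besov_seminorm_eq: "besov_seminorm \<psi> p r a = lp_gauge p (profile r a)"
proof -
  have "besov_seminorm \<psi> p r a =
      lp_gauge p (\<lambda>h. h powr (-r) * modulus_of_smoothness \<psi> (nat \<lfloor>r\<rfloor> + 1) h a)"
    by (simp add: besov_seminorm_def besov_integral_def lp_gauge_def)
  also have "\<dots> = lp_gauge p (profile r a)"
    by (rule lp_gauge_cong) (simp add: profile_def)
  finally show ?thesis .
qed

lemma profile_measurable [measurable]: "profile r a \<in> borel_measurable borel"
proof -
  have "mono (\<lambda>h. if 0 < h then modulus_of_smoothness \<psi> k h a else 0)" for k
    by (rule monoI) (auto simp: modulus_nonneg modulus_mono)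
  from borel_measurable_mono[OF this] show ?thesis
    unfolding profile_def[abs_def] by measurable
qed

lemma profile_nonneg: "0 < h \<Longrightarrow> 0 \<le> profile r a h"
  by (simp add: profile_def modulus_nonneg)

lemma profile_add_le: "0 < h \<Longrightarrow> profile r (a + b) h \<le> profile r a h + profile r b h"
  using modulus_add_le[of h "nat \<lfloor>r\<rfloor> + 1" a b]
  by (simp add: profile_def distrib_left[symmetric] mult_left_mono)

lemma profile_scaleC_le: "0 < h \<Longrightarrow> profile r (c *\<^sub>C a) h \<le> cmod c * profile r a h"
  using mult_left_mono[OF modulus_scaleC_le[of h "nat \<lfloor>r\<rfloor> + 1" c a], of "h powr (-r)"]
  by (simp add: profile_def mult_ac)

text \<open>At fixed \<open>h\<close> the profile is Lipschitz in the algebra element, by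
  subadditivity and the crude bound of the modulus by a multiple of the norm.\<close>

lemma profile_tendsto:
  assumes "f \<longlonglongrightarrow> a" "0 < h"
  shows "(\<lambda>n. profile r (f n) h) \<longlonglongrightarrow> profile r a h"
proof (rule LIM_zero_cancel, rule Lim_null_comparison)
  let ?B = "h powr (-r) * (M + 1) ^ (nat \<lfloor>r\<rfloor> + 1)"
  have le: "profile r x h - profile r y h \<le> ?B * norm (x - y)" for x y
    using profile_add_le[OF assms(2), of r "x - y" y]
      mult_left_mono[OF modulus_le_norm[of h "nat \<lfloor>r\<rfloor> + 1" "x - y"], of "h powr (-r)"] assms(2)
    by (simp add: profile_def algebra_simps)
  show "\<forall>\<^sub>F n in sequentially. norm (profile r (f n) h - profile r a h) \<le> ?B * norm (f n - a)"
    using le[of "f n" a for n] le[of a "f n" for n]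
    by (intro always_eventually allI) (simp add: abs_le_iff norm_minus_commute)
  have "(\<lambda>n. norm (f n - a)) \<longlonglongrightarrow> 0"
    using assms(1) by (simp add: LIM_zero tendsto_norm_zero)
  then show "(\<lambda>n. ?B * norm (f n - a)) \<longlonglongrightarrow> 0" by (rule tendsto_mult_right_zero)
qed

end

section \<open>The Besov space as an inverse-closed Banach algebra\<close>

locale besov = bounded_automorphism_group \<psi> M C
  for \<psi> :: "real ^ 'd \<Rightarrow> 'a::complex_banach_algebra \<Rightarrow> 'a" and M C :: real +
  fixes p :: ennreal and r :: real
  assumes p_ge_1: "1 \<le> p"
begin

text \<open>Outside the Besov space this takes the default value 0, so a bound on it carries
  information only together with membership; the closure lemmas therefore prove both at
  once.\<close>

definition seminorm :: "'a \<Rightarrow> real" where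
  "seminorm a = enn2real (lp_gauge p (profile r a))"

lemma seminorm_nonneg: "0 \<le> seminorm a"
  by (simp add: seminorm_def)

lemma besov_norm_eq: "besov_norm \<psi> p r a = norm a + seminorm a"
  by (simp add: besov_norm_def besov_seminorm_eq seminorm_def)

lemma lp_gauge_le_seminorm:
  "a \<in> besov_space \<psi> p r \<Longrightarrow> lp_gauge p (profile r a) \<le> ennreal (seminorm a)"
  by (simp add: besov_space_def besov_seminorm_eq seminorm_def)

lemma besovI: "lp_gauge p (profile r a) \<le> ennreal e \<Longrightarrow> a \<in> besov_space \<psi> p r"
  by (auto simp: besov_space_def besov_seminorm_eq intro: le_less_trans)

lemma seminorm_leI: "lp_gauge p (profile r a) \<le> ennreal e \<Longrightarrow> 0 \<le> e \<Longrightarrow> seminorm a \<le> e"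
  unfolding seminorm_def by (rule enn2real_leI)

lemma besov_seminormI:
  "lp_gauge p (profile r a) \<le> ennreal e \<Longrightarrow> 0 \<le> e \<Longrightarrow>
    a \<in> besov_space \<psi> p r \<and> seminorm a \<le> e"
  using besovI seminorm_leI by blast

lemma one_besov: "1 \<in> besov_space \<psi> p r"
proof (rule besovI)
  show "lp_gauge p (profile r 1) \<le> ennreal (0 * 0)"
  proof (rule lp_gauge_scale_le[OF p_ge_1, of "\<lambda>_. 0"])
    show "lp_gauge p (\<lambda>_. 0) \<le> ennreal 0"
      by (cases "p = \<infinity>") (simp_all add: lp_gauge_def)
    show "profile r 1 h \<le> 0 * 0" if "0 < h" for h
      using modulus_one[of "nat \<lfloor>r\<rfloor> + 1" h] that
      by (simp add: profile_def mult_nonneg_nonpos)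
  qed (auto simp: profile_nonneg)
qed

lemma besov_add:
  assumes "x \<in> besov_space \<psi> p r" "y \<in> besov_space \<psi> p r"
  shows "x + y \<in> besov_space \<psi> p r \<and> seminorm (x + y) \<le> seminorm x + seminorm y"
  using assms
  by (intro besov_seminormI lp_gauge_add_le[OF p_ge_1, of "profile r x" "profile r y"])
    (simp_all add: lp_gauge_le_seminorm profile_nonneg seminorm_nonneg profile_add_le)

lemma besov_scaleC:
  assumes "x \<in> besov_space \<psi> p r"
  shows "c *\<^sub>C x \<in> besov_space \<psi> p r \<and> seminorm (c *\<^sub>C x) \<le> cmod c * seminorm x"
  using assms
  by (intro besov_seminormI lp_gauge_scale_le[OF p_ge_1, of "profile r x"])
    (simp_all add: lp_gauge_le_seminorm profile_nonneg seminorm_nonneg profile_scaleC_le)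

lemma one_scaleC: "1 *\<^sub>C x = x" for x :: 'a
  using scaleC_of_real[of 1 x] by simp

lemma zero_scaleC: "0 *\<^sub>C x = 0" for x :: 'a
  using scaleC_of_real[of 0 x] by simp

lemma minus_one_scaleC: "(- 1) *\<^sub>C x = - x" for x :: 'a
  using scaleC_of_real[of "- 1" x] by simp

text \<open>The inequality of \<open>besov_scaleC\<close>, applied to \<open>inverse c\<close> as
  well, gives the reverse direction.\<close>

lemma seminorm_scaleC:
  assumes "x \<in> besov_space \<psi> p r"
  shows "seminorm (c *\<^sub>C x) = cmod c * seminorm x"
proof (cases "c = 0")
  case True
  then show ?thesis using besov_scaleC[OF assms, of c] seminorm_nonneg[of "c *\<^sub>C x"] by simp
next
  case False
  have "seminorm x = seminorm (inverse c *\<^sub>C (c *\<^sub>C x))"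
    using False by (simp add: scaleC_scaleC one_scaleC)
  also have "\<dots> \<le> cmod (inverse c) * seminorm (c *\<^sub>C x)"
    using besov_scaleC besov_scaleC[OF assms] by blast
  finally have "cmod c * seminorm x \<le> seminorm (c *\<^sub>C x)"
    using False by (simp add: norm_inverse norm_divide divide_simps mult.commute)
  then show ?thesis using besov_scaleC[OF assms, of c] by simp
qed

lemma besov_minus: "x \<in> besov_space \<psi> p r \<Longrightarrow> - x \<in> besov_space \<psi> p r"
  using besov_scaleC[of x "- 1"] by (simp add: minus_one_scaleC)

lemma besov_diff:
  "x \<in> besov_space \<psi> p r \<Longrightarrow> y \<in> besov_space \<psi> p r \<Longrightarrow> x - y \<in> besov_space \<psi> p r"
  using besov_add[of x "- y"] besov_minus[of y] by simp

lemma besov_mult: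
  "\<exists>K\<ge>0. \<forall>x\<in>besov_space \<psi> p r. \<forall>y\<in>besov_space \<psi> p r. x * y \<in> besov_space \<psi> p r \<and>
    seminorm (x * y) \<le> K * (norm x * seminorm y + norm y * seminorm x)"
proof -
  obtain K where K: "0 \<le> K" "\<forall>a b. \<forall>h>0.
      modulus_of_smoothness \<psi> (nat \<lfloor>r\<rfloor> + 1) h (a * b)
      \<le> K * (norm a * modulus_of_smoothness \<psi> (nat \<lfloor>r\<rfloor> + 1) h b +
          norm b * modulus_of_smoothness \<psi> (nat \<lfloor>r\<rfloor> + 1) h a)"
    using modulus_mult_le[of "nat \<lfloor>r\<rfloor> + 1"] by blast
  have profile_le: "profile r (x * y) h
      \<le> (K * norm x) * profile r y h + (K * norm y) * profile r x h" if "0 < h" for x y h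
    using mult_left_mono[OF K(2)[rule_format, OF that, of x y], of "h powr (-r)"] that
    by (simp add: profile_def algebra_simps)
  show ?thesis
  proof (rule exI, rule conjI[OF K(1)], intro ballI)
    fix x y assume xy: "x \<in> besov_space \<psi> p r" "y \<in> besov_space \<psi> p r"
    have scaled: "lp_gauge p (\<lambda>h. (K * k) * profile r z h) \<le> ennreal ((K * k) * seminorm z)"
      if "z \<in> besov_space \<psi> p r" "0 \<le> k" for z k
      using that K(1)
      by (intro lp_gauge_scale_le[OF p_ge_1, of "profile r z"])
        (simp_all add: lp_gauge_le_seminorm profile_nonneg seminorm_nonneg)
    have "lp_gauge p (profile r (x * y))
        \<le> ennreal ((K * norm x) * seminorm y + (K * norm y) * seminorm x)"
      using xy K(1) profile_le
      by (intro lp_gauge_add_le[OF p_ge_1,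
            of "\<lambda>h. (K * norm x) * profile r y h" "\<lambda>h. (K * norm y) * profile r x h"])
        (auto simp: scaled profile_nonneg seminorm_nonneg)
    then have "lp_gauge p (profile r (x * y))
        \<le> ennreal (K * (norm x * seminorm y + norm y * seminorm x))"
      by (simp add: algebra_simps)
    then show "x * y \<in> besov_space \<psi> p r \<and>
        seminorm (x * y) \<le> K * (norm x * seminorm y + norm y * seminorm x)"
      using K(1) by (intro besov_seminormI) (auto simp: seminorm_nonneg)
  qed
qed

lemma besov_norm_mult_le:
  "\<exists>K. \<forall>x\<in>besov_space \<psi> p r. \<forall>y\<in>besov_space \<psi> p r.
    besov_norm \<psi> p r (x * y) \<le> K * besov_norm \<psi> p r x * besov_norm \<psi> p r y"
proof -
  obtain K where K: "0 \<le> K"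
    "\<forall>x\<in>besov_space \<psi> p r. \<forall>y\<in>besov_space \<psi> p r. x * y \<in> besov_space \<psi> p r \<and>
    seminorm (x * y) \<le> K * (norm x * seminorm y + norm y * seminorm x)"
    using besov_mult by blast
  have "besov_norm \<psi> p r (x * y) \<le> (C + K) * besov_norm \<psi> p r x * besov_norm \<psi> p r y"
    if "x \<in> besov_space \<psi> p r" "y \<in> besov_space \<psi> p r" for x y
  proof -
    have nonneg: "0 \<le> norm x * seminorm y + norm y * seminorm x" "0 \<le> seminorm x * seminorm y"
      "0 \<le> norm x * norm y"
      by (simp_all add: seminorm_nonneg)
    have "besov_norm \<psi> p r (x * y)
        \<le> C * (norm x * norm y) + K * (norm x * seminorm y + norm y * seminorm x)"
      using op.norm_mult_le[of x y] K(2)[rule_format, OF that] by (simp add: besov_norm_eq mult_ac)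
    \<comment> \<open>\<open>norm x * norm y\<close> and the mixed sum are both parts of the
      expanded product of the Besov norms, whose terms are all nonnegative.\<close>
    also have "\<dots> \<le> C * (besov_norm \<psi> p r x * besov_norm \<psi> p r y) +
        K * (besov_norm \<psi> p r x * besov_norm \<psi> p r y)"
      using op.C_ge_1 K(1) nonneg
      by (intro add_mono mult_left_mono) (simp_all add: besov_norm_eq algebra_simps)
    finally show ?thesis by (simp add: algebra_simps)
  qed
  then show ?thesis by blast
qed

lemma inverse_closed_besov: "inverse_closed (besov_space \<psi> p r)"
  unfolding inverse_closed_def
proof (intro ballI allI impI)
  fix b c assume b: "b \<in> besov_space \<psi> p r" and "b * c = 1 \<and> c * b = 1"
  then have bc: "b * c = 1" "c * b = 1" by auto
  obtain K where K: "0 \<le> K" "\<forall>h>0. modulus_of_smoothness \<psi> (nat \<lfloor>r\<rfloor> + 1) h c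
      \<le> K * modulus_of_smoothness \<psi> (nat \<lfloor>r\<rfloor> + 1) h b"
    using modulus_inverse_le[OF bc zero_less_Suc] unfolding Suc_eq_plus1 by blast
  have "profile r c h \<le> K * profile r b h" if "0 < h" for h
    using mult_left_mono[OF K(2)[rule_format, OF that], of "h powr (-r)"] that
    by (simp add: profile_def mult_ac)
  then show "c \<in> besov_space \<psi> p r"
    using b K(1)
    by (intro besovI[OF lp_gauge_scale_le[OF p_ge_1, of "profile r b" "seminorm b" _ K]])
      (auto simp: lp_gauge_le_seminorm profile_nonneg seminorm_nonneg)
qed

text \<open>The limit is taken in the ambient algebra. Fixing \<open>n\<close> and letting the other
  index tend to infinity in the Cauchy condition bounds the gauge at \<open>f n - l\<close> by
  semicontinuity.\<close>

lemma besov_complete: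
  fixes f :: "nat \<Rightarrow> 'a"
  assumes f: "\<And>n. f n \<in> besov_space \<psi> p r"
    and cauchy: "\<And>e. 0 < e \<Longrightarrow> \<exists>K. \<forall>m\<ge>K. \<forall>n\<ge>K. besov_norm \<psi> p r (f m - f n) < e"
  shows "\<exists>l\<in>besov_space \<psi> p r. (\<lambda>n. besov_norm \<psi> p r (f n - l)) \<longlonglongrightarrow> 0"
proof -
  have "Cauchy f"
  proof (rule metric_CauchyI)
    fix e :: real assume "0 < e"
    then obtain K where "\<forall>m\<ge>K. \<forall>n\<ge>K. besov_norm \<psi> p r (f m - f n) < e" using cauchy by blast
    then have "\<forall>m\<ge>K. \<forall>n\<ge>K. dist (f m) (f n) < e"
      using seminorm_nonneg by (force simp: besov_norm_eq dist_norm intro: le_less_trans[rotated])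
    then show "\<exists>K. \<forall>m\<ge>K. \<forall>n\<ge>K. dist (f m) (f n) < e" by blast
  qed
  then obtain l where l: "f \<longlonglongrightarrow> l" using Cauchy_convergent_iff convergent_def by blast
  have tail: "\<exists>K. \<forall>n\<ge>K. lp_gauge p (profile r (f n - l)) \<le> ennreal e" if e: "0 < e" for e
  proof -
    obtain K where K: "\<forall>m\<ge>K. \<forall>n\<ge>K. besov_norm \<psi> p r (f m - f n) < e" using cauchy[OF e] by blast
    \<comment> \<open>The shift by \<open>K\<close> makes every member of the approximating sequence
      satisfy the Cauchy bound.\<close>
    have "lp_gauge p (profile r (f n - l)) \<le> ennreal e" if "K \<le> n" for n
    proof (rule lp_gauge_lim_le[OF p_ge_1, of "\<lambda>m. profile r (f n - f (m + K))"])
      show "lp_gauge p (profile r (f n - f (m + K))) \<le> ennreal e" for m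
      proof -
        have "seminorm (f n - f (m + K)) \<le> besov_norm \<psi> p r (f n - f (m + K))"
          by (simp add: besov_norm_eq)
        also have "\<dots> < e" using K that by simp
        finally show ?thesis
          using lp_gauge_le_seminorm[OF besov_diff[OF f f], of n "m + K"]
          by (meson ennreal_leI less_imp_le order_trans)
      qed
      fix h :: real assume h: "0 < h"
      have "(\<lambda>m. f n - f (m + K)) \<longlonglongrightarrow> f n - l"
        by (intro tendsto_intros LIMSEQ_ignore_initial_segment l)
      then show "(\<lambda>m. profile r (f n - f (m + K)) h) \<longlonglongrightarrow> profile r (f n - l) h"
        using h by (rule profile_tendsto)
    qed (use e in \<open>auto simp: profile_nonneg\<close>)
    then show ?thesis by blast
  qed
  have "l \<in> besov_space \<psi> p r"
  proof -
    obtain n where "lp_gauge p (profile r (f n - l)) \<le> ennreal 1" using tail[of 1] by auto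
    \<comment> \<open>\<open>l\<close> is a difference of two elements of the Besov space.\<close>
    then have "f n - (f n - l) \<in> besov_space \<psi> p r" by (intro besov_diff f besovI)
    then show ?thesis by simp
  qed
  moreover have "(\<lambda>n. seminorm (f n - l)) \<longlonglongrightarrow> 0"
  proof (rule LIMSEQ_I)
    fix e :: real assume e: "0 < e"
    then obtain K where "\<forall>n\<ge>K. lp_gauge p (profile r (f n - l)) \<le> ennreal (e / 2)"
      using tail[of "e / 2"] by auto
    then have "\<forall>n\<ge>K. seminorm (f n - l) \<le> e / 2" using e by (intro allI impI seminorm_leI) simp_all
    then have "\<forall>n\<ge>K. norm (seminorm (f n - l) - 0) < e"
      using e seminorm_nonneg by (force simp: abs_of_nonneg)
    then show "\<exists>K. \<forall>n\<ge>K. norm (seminorm (f n - l) - 0) < e" by blast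
  qed
  then have "(\<lambda>n. norm (f n - l) + seminorm (f n - l)) \<longlonglongrightarrow> 0 + 0"
    by (intro tendsto_add tendsto_norm_zero LIM_zero l)
  ultimately show ?thesis by (auto simp: besov_norm_eq)
qed

lemma banach_subalgebra_besov: "banach_subalgebra (besov_space \<psi> p r) (besov_norm \<psi> p r)"
proof -
  have zero: "0 \<in> besov_space \<psi> p r" "seminorm 0 = 0"
    using besov_scaleC[OF one_besov, of 0] seminorm_scaleC[OF one_besov, of 0]
    by (simp_all add: zero_scaleC)
  have "norm (x + y) + seminorm (x + y) \<le> norm x + seminorm x + (norm y + seminorm y)"
    if "x \<in> besov_space \<psi> p r" "y \<in> besov_space \<psi> p r" for x y
    using besov_add[OF that] norm_triangle_ineq[of x y] by linarith
  moreover have "norm x + seminorm x = 0 \<longleftrightarrow> x = 0" for x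
    using seminorm_nonneg[of x] by (auto simp: zero(2) add_nonneg_eq_0_iff)
  moreover have "\<exists>K. \<forall>x\<in>besov_space \<psi> p r. norm x \<le> K * (norm x + seminorm x)"
    by (rule exI[of _ 1]) (simp add: seminorm_nonneg)
  moreover have "x * y \<in> besov_space \<psi> p r"
    if "x \<in> besov_space \<psi> p r" "y \<in> besov_space \<psi> p r" for x y
    using besov_mult that by blast
  ultimately show ?thesis
    unfolding banach_subalgebra_def
    using besov_complete besov_norm_mult_le
    by (auto simp: zero one_besov besov_add besov_scaleC besov_norm_eq seminorm_nonneg
        seminorm_scaleC norm_scaleC distrib_left)
qed

end

section \<open>Uniform constants from the automorphism group\<close>

lemma automorphism_group_bounded:
  fixes \<psi> :: "real ^ 'd \<Rightarrow> 'a::complex_banach_algebra \<Rightarrow> 'a"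
  assumes "automorphism_group \<psi>"
  obtains M C where "bounded_automorphism_group \<psi> M C"
proof -
  have bl: "bounded_linear (\<psi> t)" and sc: "\<psi> t (c *\<^sub>C x) = c *\<^sub>C \<psi> t x"
    and mult: "\<psi> t (x * y) = \<psi> t x * \<psi> t y" and one: "\<psi> t 1 = 1"
    and comp: "\<psi> s (\<psi> t x) = \<psi> (s + t) x" for s t c x y
    using assms by (auto simp: automorphism_group_def banach_algebra_automorphism_def fun_eq_iff)
  obtain M where M: "\<And>t. onorm (\<psi> t) \<le> M"
    using assms by (auto simp: automorphism_group_def bdd_above_def)
  obtain C where C: "1 \<le> C" "\<forall>x y :: 'a. norm (x * y) \<le> C * norm x * norm y"
    using banach_algebra_mult_bound by blast
  have norm_le: "norm (\<psi> t x) \<le> max 1 M * norm x" for t x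
  proof -
    have "norm (\<psi> t x) \<le> onorm (\<psi> t) * norm x" by (rule onorm[OF bl])
    also have "\<dots> \<le> max 1 M * norm x" using M[of t] by (intro mult_right_mono) auto
    finally show ?thesis .
  qed
  \<comment> \<open>By the group law a positive power of \<open>\<psi> t\<close> is again a member
    of the group and obeys the same bound. The zeroth power is the identity, covered by
    \<open>1 \<le> max 1 M\<close>.\<close>
  have pow: "\<exists>s. \<forall>x. (\<psi> t ^^ Suc n) x = \<psi> s x" for t n
  proof (induction n)
    case (Suc n)
    then obtain s where "\<forall>x. (\<psi> t ^^ Suc n) x = \<psi> s x" ..
    then have "\<forall>x. (\<psi> t ^^ Suc (Suc n)) x = \<psi> (t + s) x"
      using comp by simp
    then show ?case ..
  qed auto
  have "norm ((\<psi> t ^^ n) x) \<le> max 1 M * norm x" for t n x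
  proof (cases n)
    case 0
    then show ?thesis using mult_right_mono[of 1 "max 1 M" "norm x"] by simp
  next
    case (Suc k)
    then show ?thesis using pow norm_le by metis
  qed
  then have "bounded_automorphism_group \<psi> (max 1 M) C"
    using bl mult one C sc
    by (intro bounded_automorphism_group.intro multiplicative_power_bounded_operator.intro
        power_bounded_operator.intro multiplicative_power_bounded_operator_axioms.intro) auto
  then show ?thesis by (rule that)
qed

theorem theorem3p8:
  fixes \<psi> :: "real ^ 'd \<Rightarrow> 'a::complex_banach_algebra \<Rightarrow> 'a"
    and p :: ennreal and r :: real
  assumes "automorphism_group \<psi>"
    and "1 \<le> p" and "0 < r"
  shows "banach_subalgebra (besov_space \<psi> p r) (besov_norm \<psi> p r) \<and>
         inverse_closed (besov_space \<psi> p r)"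
proof -
  obtain M C where "bounded_automorphism_group \<psi> M C"
    using automorphism_group_bounded[OF assms(1)] .
  then interpret bounded_automorphism_group \<psi> M C .
  interpret besov \<psi> M C p r by unfold_locales (rule assms(2))
  show ?thesis using banach_subalgebra_besov inverse_closed_besov by blast
qed

end
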